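(* For every fixed integer $k\ge 2$, $$\lim_{M\to\infty}\frac{|\Omega_{k,M}|}{|\Lambda_{k,M}|}=0 .$$
   Context: Let $R=\begin{pmatrix}3&1\\0&1\end{pmatrix}$ and $S=\begin{pmatrix}1&0\\1&2\end{pmatrix}$. For positive integers $k$ and $M$, $\Lambda_{k,M}$ denotes the set of all matrices of the form $f=R^{\beta_1}S^{\alpha_1}R^{\beta_2}S^{\alpha_2}\cdots R^{\beta_k}S^{\alpha_k}$, where the exponents are integers with $0<\alpha_i\le M$ for $1\le i<k$, $0<\beta_i\le M$ for $1<i\le k$, $0\le\beta_1\le M$ and $0\le\alpha_k\le M$. $\Omega_{k,M}$ denotes the subset of $\Lambda_{k,M}$ consisting of those matrices that have integer eigenvalues. $|X|$ denotes the cardinality of a finite set $X$. *)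

theory Defs
  imports Complex_Main "HOL-Library.FuncSet" "Jordan_Normal_Form.Char_Poly"
begin

definition R :: "int mat" where
  "R = mat_of_rows_list 2 [[3, 1], [0, 1]]"

definition S :: "int mat" where
  "S = mat_of_rows_list 2 [[1, 0], [1, 2]]"

definition word_mat :: "nat \<Rightarrow> (nat \<Rightarrow> nat) \<Rightarrow> (nat \<Rightarrow> nat) \<Rightarrow> int mat" where
  "word_mat k \<alpha> \<beta> = foldr (*) (map (\<lambda>i. R ^\<^sub>m \<beta> i * S ^\<^sub>m \<alpha> i) [1..<k + 1]) (1\<^sub>m 2)"

text \<open>The exponents are total functions on \<open>nat\<close>; only their values on \<open>{1..k}\<close> matter. The
  members of \<open>\<Lambda>\<close> are matrices: a matrix given by several exponent sequences counts once.\<close>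

definition \<Lambda> :: "nat \<Rightarrow> nat \<Rightarrow> int mat set" where
  "\<Lambda> k M = {word_mat k \<alpha> \<beta> | \<alpha> \<beta>.
     (\<forall>i. 1 \<le> i \<and> i < k \<longrightarrow> 0 < \<alpha> i \<and> \<alpha> i \<le> M) \<and>
     (\<forall>i. 1 < i \<and> i \<le> k \<longrightarrow> 0 < \<beta> i \<and> \<beta> i \<le> M) \<and>
     0 \<le> \<beta> 1 \<and> \<beta> 1 \<le> M \<and> 0 \<le> \<alpha> k \<and> \<alpha> k \<le> M}"

text \<open>Eigenvalues are taken over the complex numbers, where every nonempty square matrix has one, so
  that the condition on all of them is not vacuous.\<close>

definition has_integer_eigenvalues :: "int mat \<Rightarrow> bool" where
  "has_integer_eigenvalues A \<longleftrightarrow>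
     (\<forall>x :: complex. eigenvalue (map_mat of_int A) x \<longrightarrow> x \<in> \<int>)"

definition \<Omega> :: "nat \<Rightarrow> nat \<Rightarrow> int mat set" where
  "\<Omega> k M = {A \<in> \<Lambda> k M. has_integer_eigenvalues A}"

lemma word_mat_cong:
  assumes "\<And>i. i \<in> {1..k} \<Longrightarrow> \<alpha> i = \<alpha>' i" and "\<And>i. i \<in> {1..k} \<Longrightarrow> \<beta> i = \<beta>' i"
  shows "word_mat k \<alpha> \<beta> = word_mat k \<alpha>' \<beta>'"
  unfolding word_mat_def
  by (rule arg_cong[where f = "\<lambda>xs. foldr (*) xs (1\<^sub>m 2)"], rule map_cong) (auto simp: assms)

lemma finite_Lambda:
  assumes "k \<ge> 1"
  shows "finite (\<Lambda> k M)"
proof -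
  let ?E = "{1..k} \<rightarrow>\<^sub>E {..M}"
  have "\<Lambda> k M \<subseteq> (\<lambda>(\<alpha>, \<beta>). word_mat k \<alpha> \<beta>) ` (?E \<times> ?E)"
  proof
    fix A assume "A \<in> \<Lambda> k M"
    then obtain \<alpha> \<beta> where A: "A = word_mat k \<alpha> \<beta>"
      and \<alpha>: "\<And>i. 1 \<le> i \<Longrightarrow> i < k \<Longrightarrow> \<alpha> i \<le> M" "\<alpha> k \<le> M"
      and \<beta>: "\<And>i. 1 < i \<Longrightarrow> i \<le> k \<Longrightarrow> \<beta> i \<le> M" "\<beta> 1 \<le> M"
      unfolding \<Lambda>_def by blast
    have "\<alpha> i \<le> M" "\<beta> i \<le> M" if "i \<in> {1..k}" for i
      using that \<alpha>(1)[of i] \<alpha>(2) \<beta>(1)[of i] \<beta>(2) by (cases "i = k"; cases "i = 1"; force)+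
    then have "restrict \<alpha> {1..k} \<in> ?E" "restrict \<beta> {1..k} \<in> ?E"
      by auto
    moreover have "A = word_mat k (restrict \<alpha> {1..k}) (restrict \<beta> {1..k})"
      unfolding A by (rule word_mat_cong) auto
    ultimately show "A \<in> (\<lambda>(\<alpha>, \<beta>). word_mat k \<alpha> \<beta>) ` (?E \<times> ?E)"
      by force
  qed
  then show ?thesis
    by (rule finite_subset) (intro finite_imageI finite_cartesian_product finite_PiE; simp)
qed

end

theory Submission
  imports Defs
begin

text \<open>
  In the basis \<open>(1, 0)\<close>, \<open>(-1, 2)\<close> the generators become
  \<open>R = diag(3, 1)\<close> and the symmetric matrix \<open>S = ((3/2, 1/2), (1/2, 3/2))\<close>, both with nonnegative
  entries. Writing \<open>D\<close> for the determinant and \<open>t\<close> for the trace of a word, discarding all but one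
  diagonal path from the trace gives \<open>t \<ge> \<Prod> 3^b (2^a + 1) / 2\<close>, and dominating each factor by a
  rank one matrix gives \<open>t \<le> \<Prod> (3^b + 1) (2^a + 1) / 2\<close>. If all exponents are large in terms
  of \<open>k\<close>, it follows that \<open>2^k + D / 2^k < t < D / (2^k - 1)\<close>. But integers
  \<open>0 < m \<le> n\<close> with \<open>m n = D\<close> satisfy \<open>m + n \<le> 2^k + D / 2^k\<close> if \<open>m \<ge> 2^k\<close>, and
  \<open>m + n > D / (2^k - 1)\<close> otherwise. So a matrix in \<open>\<Omega>\<close> has an exponent below some
  constant, which leaves \<open>O(M^(2k - 1))\<close> matrices, while a ping-pong argument shows that the
  \<open>M^(2k)\<close> words with positive exponents yield distinct matrices.
\<close>

section \<open>Words as exponent lists and their action in the adapted basis\<close>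

text \<open>Each pair holds the exponent of \<open>R\<close> first. Lists replace the exponent
  functions so that proofs can use induction on the leading syllable.\<close>

fun word :: "(nat \<times> nat) list \<Rightarrow> int mat" where
  "word [] = 1\<^sub>m 2"
| "word ((b, a) # xs) = R ^\<^sub>m b * S ^\<^sub>m a * word xs"

lemma R_carrier [simp]: "R \<in> carrier_mat 2 2"
  by (rule carrier_matI) (simp_all add: R_def mat_of_rows_list_def)

lemma S_carrier [simp]: "S \<in> carrier_mat 2 2"
  by (rule carrier_matI) (simp_all add: S_def mat_of_rows_list_def)

lemma word_carrier [simp]: "word xs \<in> carrier_mat 2 2"
  by (induction xs rule: word.induct) (auto intro!: mult_carrier_mat[of _ 2 2] pow_carrier_mat)

lemma word_mat_eq_word: "word_mat k \<alpha> \<beta> = word (map (\<lambda>i. (\<beta> i, \<alpha> i)) [1..<k + 1])"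
proof -
  have "foldr (*) (map (\<lambda>i. R ^\<^sub>m \<beta> i * S ^\<^sub>m \<alpha> i) is) (1\<^sub>m 2) =
    word (map (\<lambda>i. (\<beta> i, \<alpha> i)) is)" for "is"
    by (induction "is") auto
  then show ?thesis
    by (simp add: word_mat_def)
qed

text \<open>Twice the coordinates of \<open>A (u, v)\<close> in the basis \<open>(1, 0)\<close>, \<open>(-1, 2)\<close>.\<close>

definition P :: "int mat \<Rightarrow> real \<Rightarrow> real \<Rightarrow> real" where
  "P A u v = 2 * (of_int (A $$ (0, 0)) * u + of_int (A $$ (0, 1)) * v) +
     (of_int (A $$ (1, 0)) * u + of_int (A $$ (1, 1)) * v)"

definition Q :: "int mat \<Rightarrow> real \<Rightarrow> real \<Rightarrow> real" where
  "Q A u v = of_int (A $$ (1, 0)) * u + of_int (A $$ (1, 1)) * v"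

lemma mult_2_index:
  assumes "A \<in> carrier_mat 2 2" "B \<in> carrier_mat 2 2" "i < 2" "j < 2"
  shows "(A * B) $$ (i, j) = A $$ (i, 0) * B $$ (0, j) + A $$ (i, 1) * B $$ (1, j)"
  using assms by (auto simp: scalar_prod_def numeral_2_eq_2)

lemma R_index [simp]: "R $$ (0, 0) = 3" "R $$ (0, 1) = 1" "R $$ (1, 0) = 0" "R $$ (1, 1) = 1"
  by (simp_all add: R_def mat_of_rows_list_def)

lemma S_index [simp]: "S $$ (0, 0) = 1" "S $$ (0, 1) = 0" "S $$ (1, 0) = 1" "S $$ (1, 1) = 2"
  by (simp_all add: S_def mat_of_rows_list_def)

lemma PQ_R_mult:
  assumes "X \<in> carrier_mat 2 2"
  shows "P (R * X) u v = 3 * P X u v" "Q (R * X) u v = Q X u v"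
  using assms by (simp_all add: P_def Q_def mult_2_index algebra_simps del: index_mult_mat One_nat_def)

lemma PQ_S_mult:
  assumes "X \<in> carrier_mat 2 2"
  shows "P (S * X) u v = (3 * P X u v + Q X u v) / 2" "Q (S * X) u v = (P X u v + 3 * Q X u v) / 2"
  using assms by (simp_all add: P_def Q_def mult_2_index algebra_simps del: index_mult_mat One_nat_def)

lemma PQ_R_pow_mult:
  assumes "X \<in> carrier_mat 2 2"
  shows "P (R ^\<^sub>m b * X) u v = 3 ^ b * P X u v \<and> Q (R ^\<^sub>m b * X) u v = Q X u v"
  using assms
proof (induction b arbitrary: X)
  case (Suc b)
  \<comment> \<open>Matrix powers unfold on the right, so the extra factor is absorbed into
    \<open>X\<close>; hence the induction over arbitrary \<open>X\<close>.\<close>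
  have "R ^\<^sub>m Suc b * X = R ^\<^sub>m b * (R * X)"
    using Suc.prems by (simp add: assoc_mult_mat[of _ 2 2 _ 2 _ 2])
  moreover have "R * X \<in> carrier_mat 2 2"
    using Suc.prems by (intro mult_carrier_mat[of _ 2 2]) auto
  ultimately show ?case
    using Suc.IH[of "R * X"] Suc.prems by (simp add: PQ_R_mult)
qed (simp add: R_def mat_of_rows_list_def)

text \<open>\<open>S\<close> doubles \<open>P + Q\<close> and fixes \<open>P - Q\<close>, so its
  powers have entries (2^a + 1)/2 on the diagonal and (2^a - 1)/2 off it.\<close>

lemma PQ_S_pow_mult:
  assumes "X \<in> carrier_mat 2 2"
  shows "P (S ^\<^sub>m a * X) u v = ((2 ^ a + 1) * P X u v + (2 ^ a - 1) * Q X u v) / 2 \<and>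
    Q (S ^\<^sub>m a * X) u v = ((2 ^ a - 1) * P X u v + (2 ^ a + 1) * Q X u v) / 2"
  using assms
proof (induction a arbitrary: X)
  case (Suc a)
  have "S ^\<^sub>m Suc a * X = S ^\<^sub>m a * (S * X)"
    using Suc.prems by (simp add: assoc_mult_mat[of _ 2 2 _ 2 _ 2])
  moreover have "S * X \<in> carrier_mat 2 2"
    using Suc.prems by (intro mult_carrier_mat[of _ 2 2]) auto
  ultimately show ?case
    using Suc.IH[of "S * X"] Suc.prems by (simp add: PQ_S_mult field_simps)
qed (simp add: S_def mat_of_rows_list_def)

lemma PQ_word_Nil: "P (word []) u v = 2 * u + v" "Q (word []) u v = v"
  by (simp_all add: P_def Q_def)

lemma PQ_word_Cons:
  "P (word ((b, a) # xs)) u v =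
    3 ^ b * ((2 ^ a + 1) * P (word xs) u v + (2 ^ a - 1) * Q (word xs) u v) / 2"
  "Q (word ((b, a) # xs)) u v =
    ((2 ^ a - 1) * P (word xs) u v + (2 ^ a + 1) * Q (word xs) u v) / 2"
proof -
  have "word ((b, a) # xs) = R ^\<^sub>m b * (S ^\<^sub>m a * word xs)"
    by (simp add: assoc_mult_mat[of _ 2 2 _ 2 _ 2])
  moreover have "S ^\<^sub>m a * word xs \<in> carrier_mat 2 2"
    by (intro mult_carrier_mat[of _ 2 2]) auto
  ultimately show
    "P (word ((b, a) # xs)) u v =
      3 ^ b * ((2 ^ a + 1) * P (word xs) u v + (2 ^ a - 1) * Q (word xs) u v) / 2"
    "Q (word ((b, a) # xs)) u v =
      ((2 ^ a - 1) * P (word xs) u v + (2 ^ a + 1) * Q (word xs) u v) / 2"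
    using PQ_R_pow_mult[of "S ^\<^sub>m a * word xs"] PQ_S_pow_mult[of "word xs"] by simp_all
qed

section \<open>Two-sided bounds for the trace\<close>

text \<open>The trace does not depend on the basis. The new basis vectors are (1, 0) and (-1, 2),
  and \<open>P\<close> and \<open>Q\<close> are twice the coordinates.\<close>

lemma trace_eq_PQ: "of_int (A $$ (0, 0) + A $$ (1, 1)) = (P A 1 0 + Q A (-1) 2) / 2"
  by (simp add: P_def Q_def)

text \<open>The factor is the upper left entry of R^b S^a in the new basis.\<close>

definition lower_prod :: "(nat \<times> nat) list \<Rightarrow> real" where
  "lower_prod xs = (\<Prod>(b, a)\<leftarrow>xs. 3 ^ b * (2 ^ a + 1) / 2)"

text \<open>In the new basis R^b S^a is dominated entrywise by (2^a + 1)/2 times the matrix with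
  rows (3^b, 3^b) and (1, 1). The factor is the trace of this rank one matrix, and these traces
  multiply along a word.\<close>

definition upper_prod :: "(nat \<times> nat) list \<Rightarrow> real" where
  "upper_prod xs = (\<Prod>(b, a)\<leftarrow>xs. (3 ^ b + 1) * (2 ^ a + 1) / 2)"

definition det_prod :: "(nat \<times> nat) list \<Rightarrow> real" where
  "det_prod xs = (\<Prod>(b, a)\<leftarrow>xs. 3 ^ b * 2 ^ a)"

lemma lower_prod_pos: "lower_prod xs > 0"
  unfolding lower_prod_def
  by (induction xs) (auto intro!: mult_pos_pos divide_pos_pos simp: add_pos_pos)

lemma upper_prod_pos: "upper_prod xs > 0"
  unfolding upper_prod_def
  by (induction xs) (auto intro!: mult_pos_pos divide_pos_pos simp: add_pos_pos)

lemma det_prod_ge_1: "1 \<le> det_prod xs"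
proof (induction xs)
  case (Cons x xs)
  obtain b a where x: "x = (b, a)" by force
  have "1 * 1 * 1 \<le> 3 ^ b * 2 ^ a * det_prod xs"
    using Cons by (intro mult_mono) auto
  then show ?case
    by (simp add: x det_prod_def)
qed (simp add: det_prod_def)

lemma det_prod_pos: "0 < det_prod xs"
  using det_prod_ge_1[of xs] by simp

text \<open>The hypotheses say that the start vector has nonnegative coordinates. All matrices are
  nonnegative in the new basis, so dropping the \<open>Q\<close> contribution to \<open>P\<close> at
  each syllable only decreases the value.\<close>

lemma PQ_word_lower:
  assumes "0 \<le> 2 * u + v" "0 \<le> v"
  shows "lower_prod xs * (2 * u + v) \<le> P (word xs) u v \<and> 0 \<le> Q (word xs) u v"
proof (induction xs)
  case Nil
  then show ?case
    using assms by (simp add: PQ_word_Nil lower_prod_def del: word.simps)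
next
  case (Cons x xs)
  obtain b a where x: "x = (b, a)" by force
  have p: "0 \<le> P (word xs) u v"
    using Cons lower_prod_pos[of xs] assms by (meson dual_order.trans less_imp_le mult_nonneg_nonneg)
  have a: "(1::real) \<le> 2 ^ a" by simp
  have "lower_prod (x # xs) * (2 * u + v) = 3 ^ b * (2 ^ a + 1) / 2 * (lower_prod xs * (2 * u + v))"
    by (simp add: lower_prod_def x)
  also have "\<dots> \<le> 3 ^ b * (2 ^ a + 1) / 2 * P (word xs) u v"
    using Cons by (intro mult_left_mono) auto
  also have "\<dots> \<le> P (word (x # xs)) u v"
    using Cons mult_right_mono[OF a, of "Q (word xs) u v"]
    by (simp add: x PQ_word_Cons field_simps del: word.simps)
  finally show ?case
    using Cons a p by (simp add: x PQ_word_Cons del: word.simps)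
qed

lemma P_word_Cons_upper:
  assumes "0 \<le> 2 * u + v" "0 \<le> v"
  shows "P (word ((b, a) # xs)) u v \<le> 3 ^ b * (2 ^ a + 1) / 2 * (P (word xs) u v + Q (word xs) u v)"
  using PQ_word_lower[OF assms, of xs]
  by (simp add: PQ_word_Cons field_simps del: word.simps)

lemma Q_word_Cons_upper:
  assumes "0 \<le> 2 * u + v" "0 \<le> v"
  shows "Q (word ((b, a) # xs)) u v \<le> (2 ^ a + 1) / 2 * (P (word xs) u v + Q (word xs) u v)"
proof -
  have "0 \<le> P (word xs) u v"
    using PQ_word_lower[OF assms, of xs] lower_prod_pos[of xs] assms
    by (meson dual_order.trans less_imp_le mult_nonneg_nonneg)
  then show ?thesis
    by (simp add: PQ_word_Cons field_simps del: word.simps)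
qed

lemma PQ_word_upper:
  assumes "0 \<le> 2 * u + v" "0 \<le> v"
  shows "P (word xs) u v + Q (word xs) u v \<le> upper_prod xs * (2 * u + 2 * v)"
proof (induction xs)
  case Nil
  then show ?case
    by (simp add: PQ_word_Nil upper_prod_def del: word.simps)
next
  case (Cons x xs)
  obtain b a where x: "x = (b, a)" by force
  have "P (word (x # xs)) u v + Q (word (x # xs)) u v \<le>
    (3 ^ b + 1) * (2 ^ a + 1) / 2 * (P (word xs) u v + Q (word xs) u v)"
    using P_word_Cons_upper[OF assms, of b a xs] Q_word_Cons_upper[OF assms, of b a xs]
    by (simp add: x field_simps del: word.simps)
  also have "\<dots> \<le> (3 ^ b + 1) * (2 ^ a + 1) / 2 * (upper_prod xs * (2 * u + 2 * v))"
    using Cons by (intro mult_left_mono) (auto intro!: add_nonneg_nonneg)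
  finally show ?case
    by (simp add: x upper_prod_def field_simps del: word.simps)
qed

lemma trace_word_lower: "lower_prod xs \<le> real_of_int (word xs $$ (0, 0) + word xs $$ (1, 1))"
  unfolding trace_eq_PQ
  using PQ_word_lower[of 1 0 xs] PQ_word_lower[of "-1" 2 xs] by simp

text \<open>The two rows of the leading syllable enter separately, 3^b through \<open>P\<close> and
  1 through \<open>Q\<close>; for both start vectors \<open>P + Q\<close> is initially 2. The empty
  word has trace 2 but empty product 1.\<close>

lemma trace_word_upper:
  assumes "xs \<noteq> []"
  shows "real_of_int (word xs $$ (0, 0) + word xs $$ (1, 1)) \<le> upper_prod xs"
proof -
  obtain b a ys where xs: "xs = (b, a) # ys"
    using assms by (metis list.exhaust surj_pair)
  have "P (word xs) 1 0 \<le> 3 ^ b * (2 ^ a + 1) / 2 * (P (word ys) 1 0 + Q (word ys) 1 0)"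
    unfolding xs by (rule P_word_Cons_upper) auto
  also have "\<dots> \<le> 3 ^ b * (2 ^ a + 1) / 2 * (2 * upper_prod ys)"
    using PQ_word_upper[of 1 0 ys] by (intro mult_left_mono) auto
  finally have 1: "P (word xs) 1 0 \<le> 3 ^ b * (2 ^ a + 1) * upper_prod ys"
    by simp
  have "Q (word xs) (-1) 2 \<le> (2 ^ a + 1) / 2 * (P (word ys) (-1) 2 + Q (word ys) (-1) 2)"
    unfolding xs by (rule Q_word_Cons_upper) auto
  also have "\<dots> \<le> (2 ^ a + 1) / 2 * (2 * upper_prod ys)"
    using PQ_word_upper[of "-1" 2 ys] by (intro mult_left_mono) auto
  finally have 2: "Q (word xs) (-1) 2 \<le> (2 ^ a + 1) * upper_prod ys"
    by simp
  show ?thesis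
    unfolding trace_eq_PQ using 1 2 by (simp add: xs upper_prod_def field_simps del: word.simps)
qed

section \<open>Determinants and integer eigenvalues\<close>

lemma det_2:
  fixes A :: "'a :: comm_ring_1 mat"
  assumes "A \<in> carrier_mat 2 2"
  shows "det A = A $$ (0, 0) * A $$ (1, 1) - A $$ (0, 1) * A $$ (1, 0)"
proof -
  have "det A = (\<Sum>j<2. A $$ (0, j) * cofactor A 0 j)"
    by (rule laplace_expansion_row) (use assms in auto)
  also have "\<dots> = A $$ (0, 0) * A $$ (1, 1) - A $$ (0, 1) * A $$ (1, 0)"
    using assms by (simp add: numeral_2_eq_2 cofactor_def det_single mat_delete_def)
  finally show ?thesis .
qed

lemma det_word: "of_int (det (word xs)) = det_prod xs"
proof (induction xs rule: word.induct)
  case (2 b a xs)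
  have "det (R ^\<^sub>m b) = 3 ^ b"
    by (induction b) (simp_all add: det_mult[of _ 2] det_2[of R] pow_carrier_mat del: One_nat_def)
  moreover have "det (S ^\<^sub>m a) = 2 ^ a"
    by (induction a) (simp_all add: det_mult[of _ 2] det_2[of S] pow_carrier_mat del: One_nat_def)
  moreover have "det (word ((b, a) # xs)) = det (R ^\<^sub>m b) * det (S ^\<^sub>m a) * det (word xs)"
    by (simp add: det_mult[of _ 2] pow_carrier_mat mult_carrier_mat[of _ 2 2])
  ultimately show ?case
    using 2 by (simp add: det_prod_def del: word.simps)
qed (simp add: det_prod_def)

text \<open>Once one root \<open>m\<close> of the characteristic polynomial is an integer, the other
  is the trace minus \<open>m\<close>, so exhibiting a single complex eigenvalue suffices.\<close>

lemma integer_eigenvalues_imp: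
  assumes A: "A \<in> carrier_mat 2 2" and ev: "has_integer_eigenvalues A"
  obtains m n :: int where "m + n = A $$ (0, 0) + A $$ (1, 1)" "m * n = det A"
proof -
  let ?A = "map_mat of_int A :: complex mat"
  define t where "t = A $$ (0, 0) + A $$ (1, 1)"
  define d where "d = det A"
  \<comment> \<open>The quadratic formula; \<open>csqrt\<close> covers discriminants of either
    sign.\<close>
  define x :: complex where "x = (of_int t + csqrt (of_int (t\<^sup>2 - 4 * d))) / 2"
  have x: "x * (of_int t - x) = of_int d"
  proof -
    have "4 * (x * (of_int t - x)) = of_int t ^ 2 - csqrt (of_int (t\<^sup>2 - 4 * d)) ^ 2"
      by (simp add: x_def power2_eq_square field_simps del: power2_csqrt)
    then show ?thesis by simp
  qed
  have "det (char_matrix ?A x) = 0"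
    using A x unfolding t_def d_def
    by (subst det_2) (auto simp: char_matrix_def det_2 algebra_simps)
  then have "eigenvalue ?A x"
    using A by (subst eigenvalue_det[of _ 2]) auto
  then obtain m where m: "x = of_int m"
    using ev unfolding has_integer_eigenvalues_def by (auto elim: Ints_cases)
  have "of_int (m * (t - m)) = (of_int d :: complex)"
    using x by (simp add: m)
  then have "m * (t - m) = d"
    by (simp only: of_int_eq_iff)
  then show ?thesis
    using that[of m "t - m"] by (simp add: t_def d_def)
qed

section \<open>Distinct positive words give distinct matrices\<close>

text \<open>The ratio of \<open>p\<close> and \<open>p'\<close> is an integral power of
  \<open>c\<close> lying strictly between 1/c and c, hence 1.\<close>

lemma power_scale_cancel:
  fixes c p p' :: real
  assumes "c > 1" "0 < p" "0 < p'" "p < c * p'" "p' < c * p" "c ^ m * p = c ^ n * p'"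
  shows "m = n"
proof -
  have *: "\<not> m < n" if "c ^ m * p = c ^ n * p'" "p < c * p'" "0 < p'" for m n :: nat and p p' :: real
  proof
    assume "m < n"
    then obtain d where n: "n = m + Suc d"
      using less_imp_Suc_add by auto
    have "p = c ^ Suc d * p'"
      using that(1) \<open>c > 1\<close> by (simp add: n power_add)
    moreover have "c * p' \<le> c ^ Suc d * p'"
      using \<open>c > 1\<close> that(3) by (simp add: one_le_power)
    ultimately show False
      using that(2) by simp
  qed
  show ?thesis
    using *[of m p n p'] *[of n p' m p] assms by (metis linorder_neqE_nat)
qed

text \<open>The lower bound \<open>C\<close> is used with three values: 0 to cover \<Lambda>, 1 for
  injectivity, and a large constant to exclude integer eigenvalues.\<close>

definition words :: "nat \<Rightarrow> nat \<Rightarrow> nat \<Rightarrow> (nat \<times> nat) list set" where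
  "words k C M = {xs. set xs \<subseteq> {C..M} \<times> {C..M} \<and> length xs = k}"

lemma finite_words: "finite (words k C M)"
  unfolding words_def by (rule finite_lists_length_eq) simp

lemma card_words: "card (words k C M) = (M + 1 - C) ^ (2 * k)"
  unfolding words_def
  by (subst card_lists_length_eq) (simp_all add: card_cartesian_product power_mult power2_eq_square)

text \<open>The start vector has \<open>P = 3\<close>, \<open>Q = 1\<close>, on the boundary of the
  cone. A power of \<open>S\<close> keeps \<open>P - Q\<close> and so \<open>Q \<le> P\<close>; a
  positive power of \<open>R\<close> then at least triples \<open>P\<close>.\<close>

lemma PQ_word_cone:
  assumes "set xs \<subseteq> {1..} \<times> {1..}"
  shows "0 < Q (word xs) 1 1 \<and> 3 * Q (word xs) 1 1 \<le> P (word xs) 1 1"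
  using assms
proof (induction xs)
  case (Cons x xs)
  obtain b a where x: "x = (b, a)" by force
  define p q where "p = P (word xs) 1 1" and "q = Q (word xs) 1 1"
  have pq: "0 < q" "3 * q \<le> p"
    using Cons by (auto simp: p_def q_def)
  have b: "(3::real) \<le> 3 ^ b"
    using Cons.prems power_increasing[of 1 b "3::real"] by (simp add: x)
  have a: "(1::real) \<le> 2 ^ a" by simp
  have q1: "0 < ((2 ^ a - 1) * p + (2 ^ a + 1) * q) / 2"
    using pq a by (intro divide_pos_pos add_nonneg_pos mult_nonneg_nonneg mult_pos_pos) auto
  have "3 * (((2 ^ a - 1) * p + (2 ^ a + 1) * q) / 2) \<le> 3 * (((2 ^ a + 1) * p + (2 ^ a - 1) * q) / 2)"
    using pq by (simp add: field_simps)
  also have "\<dots> \<le> 3 ^ b * (((2 ^ a + 1) * p + (2 ^ a - 1) * q) / 2)"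
    using pq a by (intro mult_right_mono b divide_nonneg_nonneg add_nonneg_nonneg mult_nonneg_nonneg) auto
  finally show ?case
    using q1 by (simp add: x PQ_word_Cons p_def q_def del: word.simps)
qed (simp add: PQ_word_Nil del: word.simps)

text \<open>In these coordinates \<open>P - Q\<close> is invariant under \<open>S\<close>, which doubles \<open>P + Q\<close>. The nontrivial
  powers of \<open>S\<close> map the cone \<open>0 < 3 Q \<le> P\<close> into the region \<open>Q < P < 3 Q\<close>, and those of \<open>R\<close> map
  this region back into the cone.\<close>

lemma PQ_word_inj:
  assumes "length xs = length ys" "set xs \<subseteq> {1..} \<times> {1..}" "set ys \<subseteq> {1..} \<times> {1..}"
    and "P (word xs) 1 1 = P (word ys) 1 1" "Q (word xs) 1 1 = Q (word ys) 1 1"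
  shows "xs = ys"
  using assms
proof (induction xs ys rule: list_induct2)
  case (Cons x xs y ys)
  obtain b a b' a' where x: "x = (b, a)" and y: "y = (b', a')" by force
  define p q p' q' where "p = P (word xs) 1 1" and "q = Q (word xs) 1 1"
    and "p' = P (word ys) 1 1" and "q' = Q (word ys) 1 1"
  have pq: "0 < q" "3 * q \<le> p" "0 < q'" "3 * q' \<le> p'"
    using Cons.prems PQ_word_cone[of xs] PQ_word_cone[of ys] by (auto simp: p_def q_def p'_def q'_def)
  define p1 q1 where "p1 = ((2 ^ a + 1) * p + (2 ^ a - 1) * q) / 2"
    and "q1 = ((2 ^ a - 1) * p + (2 ^ a + 1) * q) / 2"
  define p1' q1' where "p1' = ((2 ^ a' + 1) * p' + (2 ^ a' - 1) * q') / 2"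
    and "q1' = ((2 ^ a' - 1) * p' + (2 ^ a' + 1) * q') / 2"
  have a: "(2::real) \<le> 2 ^ a" "(2::real) \<le> 2 ^ a'"
    using Cons.prems power_increasing[of 1 a "2::real"] power_increasing[of 1 a' "2::real"]
    by (simp_all add: x y)
  have diff: "p1 - q1 = p - q" "p1' - q1' = p' - q'"
    and sum: "p1 + q1 = 2 ^ a * (p + q)" "p1' + q1' = 2 ^ a' * (p' + q')"
    by (simp_all add: p1_def q1_def p1'_def q1'_def field_simps)
  have region: "q1 < p1" "q1' < p1'"
    using diff pq by auto
  have "3 * q1 - p1 = (2 ^ a - 2) * p + (2 ^ a + 2) * q"
    "3 * q1' - p1' = (2 ^ a' - 2) * p' + (2 ^ a' + 2) * q'"
    by (simp_all add: p1_def q1_def p1'_def q1'_def field_simps)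
  moreover have "0 < (2 ^ a - 2) * p + (2 ^ a + 2) * q" "0 < (2 ^ a' - 2) * p' + (2 ^ a' + 2) * q'"
    using pq a by (auto intro!: add_nonneg_pos mult_nonneg_nonneg mult_pos_pos)
  ultimately have region': "p1 < 3 * q1" "p1' < 3 * q1'"
    by simp_all
  have eq: "3 ^ b * p1 = 3 ^ b' * p1'" "q1 = q1'"
    using Cons.prems
    by (simp_all add: x y PQ_word_Cons p_def q_def p'_def q'_def p1_def q1_def p1'_def q1'_def
        del: word.simps)
  \<comment> \<open>With \<open>q1 = q1'\<close>, both \<open>p1\<close> and \<open>p1'\<close> lie
    strictly between \<open>q1\<close> and \<open>3 * q1\<close>, so their ratio is between 1/3 and
    3.\<close>
  have "b = b'"
    by (rule power_scale_cancel[OF _ _ _ _ _ eq(1)]) (use region region' eq(2) in auto)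
  then have "p1 = p1'"
    using eq(1) by simp
  then have sum': "2 ^ a * (p + q) = 2 ^ a' * (p' + q')" and diff': "p - q = p' - q'"
    using sum diff eq(2) by simp_all
  \<comment> \<open>In the cone, \<open>p + q\<close> exceeds \<open>p - q\<close> and is at most
    twice it. As the differences agree, the ratio of the sums lies strictly between 1/2 and
    2.\<close>
  have "a = a'"
    by (rule power_scale_cancel[OF _ _ _ _ _ sum']) (use pq diff' in auto)
  then have "p = p'" "q = q'"
    using sum' diff' by auto
  then have "xs = ys"
    using Cons by (auto simp: p_def q_def p'_def q'_def)
  then show ?case
    using \<open>a = a'\<close> \<open>b = b'\<close> by (simp add: x y)
qed simp

lemma inj_on_word: "inj_on word (words k 1 M)"
proof (rule inj_onI)
  fix xs ys assume "xs \<in> words k 1 M" "ys \<in> words k 1 M" "word xs = word ys"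
  then show "xs = ys"
    by (intro PQ_word_inj) (auto simp: words_def)
qed

section \<open>Large exponents exclude integer eigenvalues\<close>

lemma det_prod_le_lower_prod: "det_prod xs \<le> 2 ^ length xs * lower_prod xs"
proof (induction xs)
  case (Cons x xs)
  obtain b a where x: "x = (b, a)" by force
  have "det_prod (x # xs) = 3 ^ b * 2 ^ a * det_prod xs"
    by (simp add: x det_prod_def)
  also have "\<dots> \<le> 3 ^ b * (2 ^ a + 1) * (2 ^ length xs * lower_prod xs)"
    using Cons det_prod_pos[of xs] by (intro mult_mono) (auto simp: less_imp_le)
  finally show ?case
    by (simp add: x lower_prod_def mult_ac)
qed (simp add: det_prod_def lower_prod_def)

text \<open>Adding 1 to a power that is at least 2^C costs at most a factor 1 + 2^(-C), twice per
  syllable.\<close>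

lemma upper_prod_le_det_prod:
  assumes "set xs \<subseteq> {C..} \<times> {C..}"
  shows "2 ^ length xs * upper_prod xs \<le> (1 + (1/2) ^ C) ^ (2 * length xs) * det_prod xs"
  using assms
proof (induction xs)
  case (Cons x xs)
  obtain b a where x: "x = (b, a)" by force
  define e :: real where "e = 1 + (1/2) ^ C"
  have "e \<ge> 1" by (simp add: e_def)
  have ba: "C \<le> b" "C \<le> a"
    using Cons.prems by (auto simp: x)
  have a: "2 ^ a + 1 \<le> e * 2 ^ a"
    using ba power_increasing[OF ba(2), of "2::real"] by (simp add: e_def field_simps)
  have "(2::real) ^ C \<le> 3 ^ b"
    using power_increasing[OF ba(1), of "2::real"] power_mono[of 2 "3::real" b] by linarith
  then have b: "3 ^ b + 1 \<le> e * 3 ^ b"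
    by (simp add: e_def field_simps)
  have ih: "2 ^ length xs * upper_prod xs \<le> e ^ (2 * length xs) * det_prod xs"
    using Cons by (auto simp: e_def)
  have "2 ^ length (x # xs) * upper_prod (x # xs) = (3 ^ b + 1) * (2 ^ a + 1) * (2 ^ length xs * upper_prod xs)"
    by (simp add: x upper_prod_def)
  also have "\<dots> \<le> (e * 3 ^ b) * (e * 2 ^ a) * (e ^ (2 * length xs) * det_prod xs)"
    using a b upper_prod_pos[of xs] \<open>e \<ge> 1\<close> by (intro mult_mono[OF mult_mono ih]) auto
  also have "\<dots> = e ^ (2 * length (x # xs)) * det_prod (x # xs)"
    by (simp add: x det_prod_def)
  finally show ?case
    by (simp add: e_def)
qed (simp add: det_prod_def upper_prod_def)

text \<open>The polynomial (x - m)(x - n) would be negative at \<open>K\<close> and positive at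
  \<open>K - 1\<close>, so it would have a root strictly between consecutive integers. The proof
  compares the smaller root with \<open>K\<close>.\<close>

lemma no_integer_roots:
  fixes m n K :: int
  assumes "K > 1" "m * n > 0" "m + n > 0" "K * (m + n) > m * n + K\<^sup>2" "(K - 1) * (m + n) < m * n"
  shows False
proof -
  have pos: "m > 0" "n > 0"
    using assms(2,3) by (auto simp: zero_less_mult_iff)
  have *: False if "m \<le> n" "m > 0" "n > 0" "K * (m + n) > m * n + K\<^sup>2" "(K - 1) * (m + n) < m * n" for m n :: int
  proof (cases "K \<le> m")
    case True
    then have "0 \<le> (m - K) * (n - K)"
      using that by (intro mult_nonneg_nonneg) auto
    then show False
      using that by (simp add: algebra_simps power2_eq_square)
  next
    case False
    then have "m * n \<le> (K - 1) * n"
      using that by (intro mult_right_mono) auto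
    moreover have "(K - 1) * n \<le> (K - 1) * (m + n)"
      using that \<open>K > 1\<close> by (intro mult_left_mono) auto
    ultimately show False
      using that by linarith
  qed
  show False
    using *[of m n] *[of n m] pos assms by (cases "m \<le> n") (simp_all add: mult.commute add.commute)
qed

lemma eventually_no_integer_eigenvalues:
  assumes "k \<ge> 1"
  obtains C where "C \<ge> 1"
    "\<And>xs. length xs = k \<Longrightarrow> set xs \<subseteq> {C..} \<times> {C..} \<Longrightarrow> \<not> has_integer_eigenvalues (word xs)"
proof -
  have K: "(2::real) ^ k > 1"
    using assms by (intro one_less_power) auto
  \<comment> \<open>The limit is 2^k - 1, so for large \<open>C\<close> the loss in the upper trace
    bound stays below the factor 2^k/(2^k - 1).\<close>
  have "(\<lambda>C. (1 + (1/2) ^ C :: real) ^ (2 * k) * (2 ^ k - 1)) \<longlonglongrightarrow> (1 + 0) ^ (2 * k) * (2 ^ k - 1)"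
    by (intro tendsto_intros) simp
  then have "\<forall>\<^sub>F C in sequentially. (1 + (1/2) ^ C :: real) ^ (2 * k) * (2 ^ k - 1) < 2 ^ k"
    by (rule order_tendstoD) simp
  \<comment> \<open>The bound \<open>2 * k \<le> C\<close> serves to give 3^b \<ge> 9^k > 4^k for
    the first exponent.\<close>
  then have "\<forall>\<^sub>F C in sequentially. 2 * k \<le> C \<and> (1 + (1/2) ^ C :: real) ^ (2 * k) * (2 ^ k - 1) < 2 ^ k"
    by (intro eventually_conj eventually_ge_at_top)
  then obtain C where C: "2 * k \<le> C" "(1 + (1/2) ^ C :: real) ^ (2 * k) * (2 ^ k - 1) < 2 ^ k"
    by (auto simp: eventually_sequentially)
  have "\<not> has_integer_eigenvalues (word xs)" if len: "length xs = k" and xs: "set xs \<subseteq> {C..} \<times> {C..}" for xs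
  proof
    assume "has_integer_eigenvalues (word xs)"
    then obtain m n where mn: "m + n = word xs $$ (0, 0) + word xs $$ (1, 1)" "m * n = det (word xs)"
      using integer_eigenvalues_imp[OF word_carrier] by metis
    define t where "t = real_of_int (m + n)"
    define d where "d = real_of_int (m * n)"
    have d: "d = det_prod xs"
      by (simp add: d_def mn(2) det_word del: of_int_mult)
    then have "d > 0"
      using det_prod_pos[of xs] by simp
    have lower: "lower_prod xs \<le> t"
      unfolding t_def mn by (rule trace_word_lower)
    have upper: "t \<le> upper_prod xs"
      unfolding t_def mn using len assms by (intro trace_word_upper) auto
    obtain b a ys where ys: "xs = (b, a) # ys"
      using len assms by (metis One_nat_def Suc_le_length_iff surj_pair)
    have "2 * k \<le> b"
      using xs C by (simp add: ys)
    have "(4::real) ^ k < 9 ^ k"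
      using assms by (intro power_strict_mono) auto
    also have "\<dots> = 3 ^ (2 * k)"
      by (simp add: power_mult)
    also have "\<dots> \<le> 3 ^ b"
      using \<open>2 * k \<le> b\<close> by (intro power_increasing) auto
    finally have b: "(4::real) ^ k < 3 ^ b" .
    \<comment> \<open>The summand 1 in \<open>2 ^ a + 1\<close> of the first syllable alone supplies
      a surplus of at least 3^b over the determinant.\<close>
    have "d + 4 ^ k < d + 3 ^ b * 1"
      using b by simp
    also have "d + 3 ^ b * 1 \<le> d + 3 ^ b * det_prod ys"
      by (intro add_left_mono mult_left_mono det_prod_ge_1) auto
    also have "\<dots> = 3 ^ b * (2 ^ a + 1) * det_prod ys"
      by (simp add: d ys det_prod_def algebra_simps)
    also have "\<dots> \<le> 3 ^ b * (2 ^ a + 1) * (2 ^ length ys * lower_prod ys)"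
      using det_prod_le_lower_prod[of ys] by (intro mult_left_mono) auto
    also have "\<dots> = 2 ^ k * lower_prod xs"
      using len by (auto simp: ys lower_prod_def)
    also have "\<dots> \<le> 2 ^ k * t"
      using lower by (intro mult_left_mono) auto
    finally have 1: "d + 4 ^ k < 2 ^ k * t" .
    have "2 ^ k * ((2 ^ k - 1) * t) \<le> (2 ^ k - 1) * (2 ^ k * upper_prod xs)"
      using upper K by (simp add: mult_left_mono)
    also have "\<dots> \<le> (2 ^ k - 1) * ((1 + (1/2) ^ C) ^ (2 * k) * d)"
      using upper_prod_le_det_prod[OF xs] K unfolding len d
      by (intro mult_left_mono) auto
    also have "\<dots> < 2 ^ k * d"
      using mult_strict_right_mono[OF C(2) \<open>d > 0\<close>] by (simp add: algebra_simps)
    finally have 2: "(2 ^ k - 1) * t < d"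
      by simp
    have "real_of_int (m * n + (2 ^ k)\<^sup>2) < real_of_int (2 ^ k * (m + n))"
      using 1 by (simp add: t_def d_def power2_eq_square flip: power_mult_distrib)
    then have 3: "m * n + (2 ^ k)\<^sup>2 < 2 ^ k * (m + n)"
      by (simp only: of_int_less_iff)
    have "real_of_int ((2 ^ k - 1) * (m + n)) < real_of_int (m * n)"
      using 2 by (simp add: t_def d_def)
    then have 4: "(2 ^ k - 1) * (m + n) < m * n"
      by (simp only: of_int_less_iff)
    have "t > 0"
      using lower lower_prod_pos[of xs] by simp
    then have 5: "m + n > 0"
      unfolding t_def by (simp only: of_int_0_less_iff)
    have 6: "m * n > 0"
      using \<open>d > 0\<close> unfolding d_def by (simp only: of_int_0_less_iff)
    have "(2::int) ^ k > 1"
      using assms by (intro one_less_power) auto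
    then show False
      using no_integer_roots 6 5 3 4 by blast
  qed
  moreover have "C \<ge> 1"
    using C assms by simp
  ultimately show ?thesis
    using that by blast
qed

section \<open>Counting matrices by words\<close>

lemma word_words_subset_Lambda:
  "word ` words k 1 M \<subseteq> \<Lambda> k M"
proof
  fix A assume "A \<in> word ` words k 1 M"
  then obtain xs where A: "A = word xs" and xs: "set xs \<subseteq> {1..M} \<times> {1..M}" "length xs = k"
    by (auto simp: words_def)
  \<comment> \<open>Exponents are indexed from 1, lists from 0. The default 0 keeps the bound by
    \<open>M\<close> valid at every index, including \<open>\<beta> 1\<close> when
    \<open>k = 0\<close>.\<close>
  define \<alpha> \<beta> where "\<alpha> i = (if i \<in> {1..k} then snd (xs ! (i - 1)) else 0)"
    and "\<beta> i = (if i \<in> {1..k} then fst (xs ! (i - 1)) else 0)" for i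
  have "map (\<lambda>i. (\<beta> i, \<alpha> i)) [1..<k + 1] = xs"
    using xs(2) by (intro nth_equalityI) (auto simp: \<alpha>_def \<beta>_def simp del: upt_Suc)
  then have "A = word_mat k \<alpha> \<beta>"
    by (simp add: A word_mat_eq_word)
  moreover have "0 < \<alpha> i \<and> \<alpha> i \<le> M \<and> 0 < \<beta> i \<and> \<beta> i \<le> M" if "i \<in> {1..k}" for i
  proof -
    have "xs ! (i - 1) \<in> {1..M} \<times> {1..M}"
      using xs that by (intro subsetD[OF xs(1)] nth_mem) auto
    then show ?thesis
      using that by (auto simp: \<alpha>_def \<beta>_def mem_Times_iff)
  qed
  moreover have "\<alpha> i \<le> M" "\<beta> i \<le> M" for i
    using calculation(2)[of i] by (cases "i \<in> {1..k}"; auto simp: \<alpha>_def \<beta>_def)+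
  ultimately show "A \<in> \<Lambda> k M"
    unfolding \<Lambda>_def by (intro CollectI exI[of _ \<alpha>] exI[of _ \<beta>]) auto
qed

lemma Lambda_subset_word_words:
  assumes "k \<ge> 1"
  shows "\<Lambda> k M \<subseteq> word ` words k 0 M"
proof
  fix A assume "A \<in> \<Lambda> k M"
  then obtain \<alpha> \<beta> where A: "A = word_mat k \<alpha> \<beta>"
    and \<alpha>: "\<And>i. 1 \<le> i \<Longrightarrow> i < k \<Longrightarrow> \<alpha> i \<le> M" "\<alpha> k \<le> M"
    and \<beta>: "\<And>i. 1 < i \<Longrightarrow> i \<le> k \<Longrightarrow> \<beta> i \<le> M" "\<beta> 1 \<le> M"
    unfolding \<Lambda>_def by blast
  have "\<alpha> i \<le> M" "\<beta> i \<le> M" if "i \<in> {1..k}" for i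
    using that \<alpha>(1)[of i] \<alpha>(2) \<beta>(1)[of i] \<beta>(2) by (cases "i = k"; cases "i = 1"; force)+
  then have "map (\<lambda>i. (\<beta> i, \<alpha> i)) [1..<k + 1] \<in> words k 0 M"
    by (auto simp: words_def simp del: upt_Suc)
  then show "A \<in> word ` words k 0 M"
    unfolding A word_mat_eq_word by blast
qed

lemma card_Lambda_lower:
  assumes "k \<ge> 1"
  shows "M ^ (2 * k) \<le> card (\<Lambda> k M)"
  using card_mono[OF finite_Lambda[OF assms] word_words_subset_Lambda[of k M]]
  unfolding card_image[OF inj_on_word] card_words by simp

text \<open>Every matrix in \<Omega> comes from a word with some exponent below \<open>C\<close>.
  Several words may give one matrix, which is harmless for an upper bound.\<close>

lemma card_Omega_upper:
  assumes "k \<ge> 1" "C \<ge> 1"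
    and "\<And>xs. length xs = k \<Longrightarrow> set xs \<subseteq> {C..} \<times> {C..} \<Longrightarrow> \<not> has_integer_eigenvalues (word xs)"
  shows "card (\<Omega> k M) \<le> (M + 1) ^ (2 * k) - (M + 1 - C) ^ (2 * k)"
proof -
  have "\<Omega> k M \<subseteq> word ` (words k 0 M - words k C M)"
  proof
    fix A assume "A \<in> \<Omega> k M"
    then obtain xs where xs: "A = word xs" "xs \<in> words k 0 M" "has_integer_eigenvalues (word xs)"
      using Lambda_subset_word_words[OF assms(1)] by (auto simp: \<Omega>_def)
    moreover have "xs \<notin> words k C M"
      using xs(3) assms(3)[of xs] by (fastforce simp: words_def)
    ultimately show "A \<in> word ` (words k 0 M - words k C M)"
      by blast
  qed
  then have "card (\<Omega> k M) \<le> card (words k 0 M - words k C M)"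
    by (meson card_image_le card_mono dual_order.trans finite_Diff finite_imageI finite_words)
  also have "\<dots> = card (words k 0 M) - card (words k C M)"
    by (intro card_Diff_subset finite_words) (auto simp: words_def)
  finally show ?thesis
    by (simp add: card_words)
qed

section \<open>Passage to the limit\<close>

theorem theorem1:
  fixes k :: nat
  assumes "k \<ge> 2"
  shows "(\<lambda>M. real (card (\<Omega> k M)) / real (card (\<Lambda> k M))) \<longlonglongrightarrow> 0"
proof -
  have k: "k \<ge> 1" using assms by simp
  obtain C where C: "C \<ge> 1"
    "\<And>xs. length xs = k \<Longrightarrow> set xs \<subseteq> {C..} \<times> {C..} \<Longrightarrow> \<not> has_integer_eigenvalues (word xs)"
    using eventually_no_integer_eigenvalues[OF k] by blast
  \<comment> \<open>The bound for \<Omega> divided by M^(2k); both powers tend to 1.\<close>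
  let ?u = "\<lambda>M::nat. (1 + 1 / real M) ^ (2 * k) - (1 + (1 - real C) / real M) ^ (2 * k)"
  have "?u \<longlonglongrightarrow> (1 + 0) ^ (2 * k) - (1 + 0) ^ (2 * k)"
    by (intro tendsto_intros lim_const_over_n)
  then have lim: "?u \<longlonglongrightarrow> 0"
    by simp
  have "\<forall>\<^sub>F M in sequentially. real (card (\<Omega> k M)) / real (card (\<Lambda> k M)) \<le> ?u M"
    \<comment> \<open>From \<open>C\<close> on, \<open>M\<close> is positive and the natural
      subtraction in \<open>M + 1 - C\<close> is not truncated.\<close>
    using eventually_ge_at_top[of C]
  proof eventually_elim
    case (elim M)
    then have M: "M > 0" using C(1) by simp
    have "real (card (\<Omega> k M)) \<le> real ((M + 1) ^ (2 * k) - (M + 1 - C) ^ (2 * k))"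
      using card_Omega_upper[OF k C] by (simp only: of_nat_le_iff)
    also have "\<dots> = real (M + 1) ^ (2 * k) - real (M + 1 - C) ^ (2 * k)"
      by (subst of_nat_diff) (auto intro: power_mono)
    finally have num: "real (card (\<Omega> k M)) \<le> real (M + 1) ^ (2 * k) - real (M + 1 - C) ^ (2 * k)" .
    have den: "real M ^ (2 * k) \<le> real (card (\<Lambda> k M))"
      using card_Lambda_lower[OF k, of M] by (metis of_nat_le_iff of_nat_power)
    have "real (card (\<Omega> k M)) / real (card (\<Lambda> k M)) \<le>
      (real (M + 1) ^ (2 * k) - real (M + 1 - C) ^ (2 * k)) / real M ^ (2 * k)"
      using num den M by (intro frac_le) (auto intro: order_trans[rotated, OF num])
    also have "\<dots> = (real (M + 1) / real M) ^ (2 * k) - (real (M + 1 - C) / real M) ^ (2 * k)"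
      by (simp only: diff_divide_distrib power_divide)
    also have "real (M + 1) / real M = 1 + 1 / real M"
      using M by (simp add: field_simps)
    also have "real (M + 1 - C) / real M = 1 + (1 - real C) / real M"
      using M elim by (simp add: field_simps of_nat_diff)
    finally show ?case .
  qed
  then show ?thesis
    by (intro tendsto_sandwich[OF _ _ tendsto_const lim]) auto
qed

end
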